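(* Let $\ell_2(u,y)=(u-y)^2$ be the squared loss. There exist universal constants $c,c'>0$ such that for every $\lambda>0$ and all positive integers $m,B$: \begin{itemize} \item If $1\leq B\leq \frac{1}{\lambda^2}\leq cm^2$, then for any budgeted algorithm with budget $B$ there exist an $m\times m$ kernel matrix $K$ and target values $y=(y_1,\dots,y_m)$ in $[-1,+1]$ such that the returned coefficient vector $\boldsymbol{\alpha}$ satisfies $\Delta_{\ell_2}(m,\boldsymbol{\alpha},K,\lambda,y)\ge c'$. \item If $\frac{1}{\lambda^2}\leq B\leq cm^2$, then for any budgeted algorithm with budget $B$ there exist an $m\times m$ kernel matrix $K$ and target values $y=(y_1,\dots,y_m)$ in $[-1,+1]$ such that the returned coefficient vector $\boldsymbol{\alpha}$ satisfies $\Delta_{\ell_2}(m,\boldsymbol{\alpha},K,\lambda,y)\ge c'(\lambda \sqrt{B})^{-3}$. \end{itemize}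
   Context: For a loss $\ell$, an $m\times m$ kernel matrix $K$ (symmetric positive semidefinite), a vector $\boldsymbol{\alpha}\in\mathbb{R}^m$, targets $y=(y_1,\dots,y_m)$ and $\lambda>0$, with $\boldsymbol{e}_1,\dots,\boldsymbol{e}_m$ the standard basis of $\mathbb{R}^m$, \[ \Delta_\ell(m,\boldsymbol{\alpha},K,\lambda,y)=\left(\frac{1}{m}\sum_{t=1}^{m}\ell\left(\boldsymbol{\alpha}^\top K \boldsymbol{e}_t,y_t\right)+\frac{\lambda}{2}\boldsymbol{\alpha}^\top K \boldsymbol{\alpha}\right) - \min_{\boldsymbol{a}\in\mathbb{R}^m}\left(\frac{1}{m}\sum_{t=1}^{m}\ell\left(\boldsymbol{a}^\top K \boldsymbol{e}_t,y_t\right)+\frac{\lambda}{2}\boldsymbol{a}^\top K \boldsymbol{a}\right). \] Budgeted algorithm: the algorithm is given the target values $y_1,\dots,y_m$ but not the kernel matrix $K$. It may (adaptively) query at most $B$ entries of $K$, and then returns a coefficient vector $\boldsymbol{\alpha}\in\mathbb{R}^m$ based on this information. If the algorithm is randomized, $\Delta_\ell$ of the returned vector is understood in expectation over the algorithm's internal randomness. *)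

theory Defs
  imports "HOL-Probability.Probability" "Jordan_Normal_Form.Matrix"
begin

no_notation inner (infix \<open>\<bullet>\<close> 70)
no_notation vec_nth (infixl \<open>$\<close> 90)

hide_type (open) Finite_Cartesian_Product.vec
hide_const (open) Finite_Cartesian_Product.vec Finite_Cartesian_Product.mat

(* Vectors and matrices are those of Jordan_Normal_Form (the dimension is a value), so
   coordinates and matrix entries are numbered 0, ..., m - 1 instead of 1, ..., m. *)

definition kernel_matrix :: "nat \<Rightarrow> real mat \<Rightarrow> bool" where
  "kernel_matrix m K \<longleftrightarrow>
     K \<in> carrier_mat m m \<and> K\<^sup>T = K \<and> (\<forall>v \<in> carrier_vec m. 0 \<le> v \<bullet> (K *\<^sub>v v))"

definition squared_loss :: "real \<Rightarrow> real \<Rightarrow> real" where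
  "squared_loss u y = (u - y)\<^sup>2"

definition objective ::
  "(real \<Rightarrow> real \<Rightarrow> real) \<Rightarrow> nat \<Rightarrow> real vec \<Rightarrow> real mat \<Rightarrow> real \<Rightarrow> real vec \<Rightarrow> real" where
  "objective loss m \<alpha> K lam y =
     (1 / real m) * (\<Sum>t<m. loss (\<alpha> \<bullet> (K *\<^sub>v unit_vec m t)) (y $ t))
       + lam / 2 * (\<alpha> \<bullet> (K *\<^sub>v \<alpha>))"

(* The infimum is a minimum for the squared loss, lam > 0 and a positive semidefinite K. *)
definition Delta ::
  "(real \<Rightarrow> real \<Rightarrow> real) \<Rightarrow> nat \<Rightarrow> real vec \<Rightarrow> real mat \<Rightarrow> real \<Rightarrow> real vec \<Rightarrow> real" where
  "Delta loss m \<alpha> K lam y =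
     objective loss m \<alpha> K lam y - (INF a \<in> carrier_vec m. objective loss m a K lam y)"

(* A deterministic adaptive procedure: either return a coefficient vector, or ask for the
   entry (i, j) and continue depending on its value. *)
datatype strategy =
    Return "real vec"
  | Query nat nat "real \<Rightarrow> strategy"

primrec returned :: "real mat \<Rightarrow> strategy \<Rightarrow> real vec" where
  "returned K (Return \<alpha>) = \<alpha>"
| "returned K (Query i j s) = returned K (s (K $$ (i, j)))"

primrec queried :: "real mat \<Rightarrow> strategy \<Rightarrow> (nat \<times> nat) set" where
  "queried K (Return \<alpha>) = {}"
| "queried K (Query i j s) = insert (i, j) (queried K (s (K $$ (i, j))))"

(* A deterministic algorithm sees the targets and then follows an adaptive procedure.
   Distinct entries are counted, so asking again for a known entry is free. *)
definition budgeted_algorithm :: "nat \<Rightarrow> nat \<Rightarrow> (real vec \<Rightarrow> strategy) \<Rightarrow> bool" where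
  "budgeted_algorithm m B A \<longleftrightarrow>
     (\<forall>y \<in> carrier_vec m. \<forall>K. kernel_matrix m K \<longrightarrow>
        queried K (A y) \<subseteq> {..<m} \<times> {..<m} \<and> card (queried K (A y)) \<le> B \<and>
        returned K (A y) \<in> carrier_vec m)"

(* A randomized algorithm is a probability law on deterministic ones, every one of which
   respects the budget, such that each returned coordinate is a random variable.
   An algorithm driven by a random seed from any probability space is covered: push the
   law of the seed forward along the map from seeds to deterministic algorithms, to the
   largest sigma-algebra that makes this map measurable.
   A deterministic algorithm is the case of a point mass. *)
definition randomized_budgeted_algorithm ::
  "nat \<Rightarrow> nat \<Rightarrow> (real vec \<Rightarrow> strategy) measure \<Rightarrow> bool" where
  "randomized_budgeted_algorithm m B P \<longleftrightarrow>
     prob_space P \<and>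
     (\<forall>A \<in> space P. budgeted_algorithm m B A) \<and>
     (\<forall>y \<in> carrier_vec m. \<forall>K. kernel_matrix m K \<longrightarrow>
        (\<forall>i<m. (\<lambda>A. returned K (A y) $ i) \<in> borel_measurable P))"

(* Delta is nonnegative when the loss is nonnegative, lam > 0 and K is a kernel matrix, so
   ennreal truncates nothing; the expectation is infinite if Delta is not integrable. *)
definition expected_Delta ::
  "(real \<Rightarrow> real \<Rightarrow> real) \<Rightarrow> nat \<Rightarrow> (real vec \<Rightarrow> strategy) measure \<Rightarrow> real mat \<Rightarrow> real \<Rightarrow> real vec
     \<Rightarrow> ennreal" where
  "expected_Delta loss m P K lam y =
     (\<integral>\<^sup>+ A. ennreal (Delta loss m (returned K (A y)) K lam y) \<partial>P)"

definition target_values :: "nat \<Rightarrow> real vec \<Rightarrow> bool" where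
  "target_values m y \<longleftrightarrow> y \<in> carrier_vec m \<and> (\<forall>t<m. y $ t \<in> {-1..1})"

end

theory Submission
  imports Defs
begin

text \<open>
  Kernel matrices may be rescaled freely, so the regularization can be made negligible, and a
  constant lower bound holds for all \<open>B \<le> m\<^sup>2 / 1024\<close>; it implies both parts. All targets are 1 and,
  up to scaling, the base kernel is \<open>(m + 1) I - J\<close>, with \<open>J\<close> the all-ones matrix. It maps the
  all-ones vector to itself and multiplies its orthogonal complement by \<open>m + 1\<close>, so all coordinates
  of a coefficient vector with small loss are bounded away from 0. Adding \<open>m + 1\<close> to the entries
  \<open>(i, j)\<close> and \<open>(j, i)\<close> keeps the matrix positive semidefinite, but moves the prediction at \<open>i\<close> by
  an amount of order \<open>m\<close>, which increases the average loss by an amount of order \<open>m\<close>. A budget of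
  \<open>m\<^sup>2 / 1024\<close> entries misses most of these perturbations; averaging over them handles randomized
  algorithms.
\<close>

section \<open>Runs of a strategy, and general facts about \<open>Delta\<close>\<close>

text \<open>Along the run on \<open>K\<close> every answer is the same for \<open>K'\<close>, so by
  induction both runs take the same branches. An algorithm therefore cannot react to changes outside
  the entries it has read.\<close>

lemma returned_cong:
  assumes "\<And>i j. (i, j) \<in> queried K S \<Longrightarrow> K' $$ (i, j) = K $$ (i, j)"
  shows "returned K' S = returned K S"
  using assms by (induction S) auto

lemma objective_eq_sums:
  assumes "\<alpha> \<in> carrier_vec m" "K \<in> carrier_mat m m"
  shows "objective loss m \<alpha> K lam y =
    (1 / real m) * (\<Sum>t<m. loss (\<Sum>a<m. \<alpha> $ a * K $$ (a, t)) (y $ t))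
      + lam / 2 * (\<Sum>a<m. \<alpha> $ a * (\<Sum>b<m. K $$ (a, b) * \<alpha> $ b))"
proof -
  have "\<alpha> \<bullet> (K *\<^sub>v unit_vec m t) = (\<Sum>a<m. \<alpha> $ a * K $$ (a, t))" if "t < m" for t
    using assms that
    by (auto simp: scalar_prod_def atLeast0LessThan if_distrib[of "(*) _"] cong: if_cong
        intro!: sum.cong)
  moreover have "\<alpha> \<bullet> (K *\<^sub>v \<alpha>) = (\<Sum>a<m. \<alpha> $ a * (\<Sum>b<m. K $$ (a, b) * \<alpha> $ b))"
    using assms by (auto simp: scalar_prod_def atLeast0LessThan intro!: sum.cong)
  ultimately show ?thesis
    unfolding objective_def by (auto intro!: sum.cong)
qed

lemma objective_ge_loss:
  assumes "kernel_matrix m K" "lam > 0" "\<alpha> \<in> carrier_vec m"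
  shows "(1 / real m) * (\<Sum>t<m. loss (\<alpha> \<bullet> (K *\<^sub>v unit_vec m t)) (y $ t)) \<le> objective loss m \<alpha> K lam y"
  using assms unfolding kernel_matrix_def objective_def by simp

text \<open>The infimum lies below the value at any competitor \<open>a\<close>. As
  \<open>INF\<close> over the reals has this property only for sets bounded below, nonnegativity of
  the objective comes first.\<close>

lemma Delta_ge:
  assumes "kernel_matrix m K" "lam > 0" "a \<in> carrier_vec m"
  shows "objective squared_loss m \<alpha> K lam y - objective squared_loss m a K lam y
    \<le> Delta squared_loss m \<alpha> K lam y"
proof -
  have "0 \<le> objective squared_loss m b K lam y" if "b \<in> carrier_vec m" for b
    by (rule order_trans[OF _ objective_ge_loss[OF assms(1,2) that]])
      (auto simp: squared_loss_def intro!: sum_nonneg divide_nonneg_nonneg)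
  hence "bdd_below ((\<lambda>b. objective squared_loss m b K lam y) ` carrier_vec m)"
    by (intro bdd_belowI2)
  from cINF_lower[OF this assms(3)] show ?thesis
    unfolding Delta_def by simp
qed

lemma Delta_nonneg:
  assumes "kernel_matrix m K" "lam > 0" "\<alpha> \<in> carrier_vec m"
  shows "0 \<le> Delta squared_loss m \<alpha> K lam y"
  using Delta_ge[OF assms, of \<alpha> y] by simp

text \<open>With \<open>K\<close> and \<open>y\<close> fixed, the infimum is constant in
  \<open>A\<close>, and the objective is a polynomial in the returned coordinates, which are
  measurable by assumption.\<close>

lemma Delta_measurable:
  assumes "randomized_budgeted_algorithm m B P" "kernel_matrix m K" "y \<in> carrier_vec m"
  shows "(\<lambda>A. Delta squared_loss m (returned K (A y)) K lam y) \<in> borel_measurable P"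
proof -
  have K: "K \<in> carrier_mat m m"
    using assms(2) by (simp add: kernel_matrix_def)
  have [measurable]: "(\<lambda>A. returned K (A y) $ i) \<in> borel_measurable P" if "i \<in> {..<m}" for i
    using assms that unfolding randomized_budgeted_algorithm_def by blast
  have "returned K (A y) \<in> carrier_vec m" if "A \<in> space P" for A
    using assms that unfolding randomized_budgeted_algorithm_def budgeted_algorithm_def by blast
  hence eq: "Delta squared_loss m (returned K (A y)) K lam y =
      (1 / real m) * (\<Sum>t<m. ((\<Sum>a<m. returned K (A y) $ a * K $$ (a, t)) - y $ t)\<^sup>2)
      + lam / 2 * (\<Sum>a<m. returned K (A y) $ a * (\<Sum>b<m. K $$ (a, b) * returned K (A y) $ b))
      - (INF a \<in> carrier_vec m. objective squared_loss m a K lam y)" if "A \<in> space P" for A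
    unfolding Delta_def using that by (subst objective_eq_sums[OF _ K]) (auto simp: squared_loss_def)
  show ?thesis
    by (subst measurable_cong[OF eq]) simp_all
qed

section \<open>The perturbed kernels and their quadratic form\<close>

text \<open>Taking a set \<open>E\<close> of entries covers three cases at once: the empty set gives
  the base kernel, a mirrored pair an off-diagonal perturbation, a singleton a diagonal one.\<close>

definition perturbed_kernel :: "real \<Rightarrow> nat \<Rightarrow> (nat \<times> nat) set \<Rightarrow> real mat" where
  "perturbed_kernel s m E = mat m m (\<lambda>p. s *
     ((if fst p = snd p then real m + 1 else 0) - 1 + (if p \<in> E then real m + 1 else 0)))"

lemma perturbed_kernel_carrier [simp]: "perturbed_kernel s m E \<in> carrier_mat m m"
  by (simp add: perturbed_kernel_def)

lemma perturbed_kernel_index: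
  "a < m \<Longrightarrow> b < m \<Longrightarrow> perturbed_kernel s m E $$ (a, b) =
    s * ((if a = b then real m + 1 else 0) - 1 + (if (a, b) \<in> E then real m + 1 else 0))"
  by (simp add: perturbed_kernel_def)

lemma perturbed_kernel_row:
  assumes "a < m"
  shows "(\<Sum>b<m. perturbed_kernel s m E $$ (a, b) * v $ b) =
    s * ((real m + 1) * v $ a - (\<Sum>b<m. v $ b) + (real m + 1) * (\<Sum>b | b < m \<and> (a, b) \<in> E. v $ b))"
proof -
  have "(\<Sum>b<m. perturbed_kernel s m E $$ (a, b) * v $ b) =
    (\<Sum>b<m. s * ((real m + 1) * (if a = b then v $ b else 0) - v $ b
      + (real m + 1) * (if (a, b) \<in> E then v $ b else 0)))"
    using assms by (intro sum.cong) (auto simp: perturbed_kernel_index algebra_simps)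
  also have "\<dots> = s * ((real m + 1) * (\<Sum>b<m. if a = b then v $ b else 0) - (\<Sum>b<m. v $ b)
      + (real m + 1) * (\<Sum>b<m. if (a, b) \<in> E then v $ b else 0))"
    by (simp only: sum_distrib_left[symmetric] sum.distrib sum_subtractf)
  also have "(\<Sum>b<m. if (a, b) \<in> E then v $ b else 0) = (\<Sum>b | b < m \<and> (a, b) \<in> E. v $ b)"
    by (auto simp: sum.inter_filter[symmetric] intro!: sum.cong)
  finally show ?thesis
    using assms by simp
qed

lemma perturbed_kernel_prediction:
  assumes "\<alpha> \<in> carrier_vec m" "t < m" "sym E"
  shows "\<alpha> \<bullet> (perturbed_kernel s m E *\<^sub>v unit_vec m t) =
    s * ((real m + 1) * \<alpha> $ t - (\<Sum>b<m. \<alpha> $ b) + (real m + 1) * (\<Sum>b | b < m \<and> (t, b) \<in> E. \<alpha> $ b))"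
proof -
  have "\<alpha> \<bullet> (perturbed_kernel s m E *\<^sub>v unit_vec m t) =
      (\<Sum>a<m. \<alpha> $ a * perturbed_kernel s m E $$ (a, t))"
    using assms carrier_matD[OF perturbed_kernel_carrier[of s m E]]
    by (auto simp: scalar_prod_def atLeast0LessThan if_distrib[of "(*) _"] cong: if_cong
        intro!: sum.cong)
  also have "\<dots> = (\<Sum>a<m. perturbed_kernel s m E $$ (t, a) * \<alpha> $ a)"
    using assms by (intro sum.cong) (auto simp: perturbed_kernel_index dest: symD)
  finally show ?thesis
    using perturbed_kernel_row[OF assms(2)] by simp
qed

text \<open>The sum of squares is the sum of squared deviations from the mean \<open>\<mu>\<close>
  plus \<open>m * \<mu>\<^sup>2\<close>, and the latter pays for the squared sum. The deviations at
  \<open>i\<close> and \<open>j\<close> alone absorb the cross term, because together they complete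
  to \<open>(v i + v j - \<mu>)\<^sup>2 + \<mu>\<^sup>2\<close>.\<close>

lemma perturbed_form_nonneg:
  fixes v :: "nat \<Rightarrow> real"
  assumes "i < m" "j < m" "i \<noteq> j"
  shows "0 \<le> (real m + 1) * (\<Sum>b<m. (v b)\<^sup>2) - (\<Sum>b<m. v b)\<^sup>2 + (real m + 1) * (2 * v i * v j)"
proof -
  define S where "S = (\<Sum>b<m. v b)"
  define \<mu> where "\<mu> = S / m"
  have m: "real m > 0" and S: "S = m * \<mu>"
    using assms by (auto simp: \<mu>_def)
  have "(\<Sum>b<m. (v b - \<mu>)\<^sup>2) = (\<Sum>b<m. (v b)\<^sup>2) - 2 * \<mu> * S + m * \<mu>\<^sup>2"
    by (simp add: power2_diff sum.distrib sum_subtractf S_def sum_distrib_left sum_distrib_right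
        algebra_simps)
  hence var: "(\<Sum>b<m. (v b)\<^sup>2) = (\<Sum>b<m. (v b - \<mu>)\<^sup>2) + m * \<mu>\<^sup>2"
    by (simp add: S power2_eq_square)
  have "(v i - \<mu>)\<^sup>2 + (v j - \<mu>)\<^sup>2 = (\<Sum>b\<in>{i, j}. (v b - \<mu>)\<^sup>2)"
    using assms by simp
  also have "\<dots> \<le> (\<Sum>b<m. (v b - \<mu>)\<^sup>2)"
    using assms by (intro sum_mono2) auto
  finally have "(v i - \<mu>)\<^sup>2 + (v j - \<mu>)\<^sup>2 \<le> (\<Sum>b<m. (v b - \<mu>)\<^sup>2)" .
  moreover have "0 \<le> (v i - \<mu>)\<^sup>2 + (v j - \<mu>)\<^sup>2 + 2 * v i * v j"
  proof -
    have "(v i - \<mu>)\<^sup>2 + (v j - \<mu>)\<^sup>2 + 2 * v i * v j = (v i + v j - \<mu>)\<^sup>2 + \<mu>\<^sup>2"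
      by (simp add: power2_eq_square algebra_simps)
    thus ?thesis by simp
  qed
  ultimately have "0 \<le> (real m + 1) * ((\<Sum>b<m. (v b - \<mu>)\<^sup>2) + 2 * v i * v j)"
    by simp
  moreover have "(real m + 1) * (m * \<mu>\<^sup>2) - S\<^sup>2 = m * \<mu>\<^sup>2"
    by (simp add: S power2_eq_square algebra_simps)
  moreover have "0 \<le> m * \<mu>\<^sup>2"
    by simp
  ultimately show ?thesis
    unfolding var S_def[symmetric] by (simp add: algebra_simps)
qed

lemma perturbed_form_eq:
  assumes "v \<in> carrier_vec m"
  shows "v \<bullet> (perturbed_kernel s m E *\<^sub>v v) =
    s * ((real m + 1) * (\<Sum>b<m. (v $ b)\<^sup>2) - (\<Sum>b<m. v $ b)\<^sup>2
      + (real m + 1) * (\<Sum>a<m. v $ a * (\<Sum>b | b < m \<and> (a, b) \<in> E. v $ b)))"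
proof -
  have "v \<bullet> (perturbed_kernel s m E *\<^sub>v v) =
      (\<Sum>a<m. v $ a * (\<Sum>b<m. perturbed_kernel s m E $$ (a, b) * v $ b))"
    using assms carrier_matD[OF perturbed_kernel_carrier[of s m E]]
    by (auto simp: scalar_prod_def atLeast0LessThan intro!: sum.cong)
  also have "\<dots> = (\<Sum>a<m. s * ((real m + 1) * (v $ a)\<^sup>2 - v $ a * (\<Sum>b<m. v $ b)
      + (real m + 1) * (v $ a * (\<Sum>b | b < m \<and> (a, b) \<in> E. v $ b))))"
    by (intro sum.cong refl, subst perturbed_kernel_row) (auto simp: power2_eq_square algebra_simps)
  also have "\<dots> = s * ((real m + 1) * (\<Sum>b<m. (v $ b)\<^sup>2) - (\<Sum>b<m. v $ b)\<^sup>2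
      + (real m + 1) * (\<Sum>a<m. v $ a * (\<Sum>b | b < m \<and> (a, b) \<in> E. v $ b)))"
    by (simp only: sum_distrib_left[symmetric] sum.distrib sum_subtractf sum_distrib_right[symmetric])
      (simp add: power2_eq_square)
  finally show ?thesis .
qed

lemma sum_single_partner:
  assumes "i < m" "j < m"
  shows "(\<Sum>b | b < m \<and> (a, b) \<in> {(i, j), (j, i)}. f b :: real) =
    (if a = i then f j else if a = j then f i else 0)"
proof -
  have "{b. b < m \<and> (a, b) \<in> {(i, j), (j, i)}} = (if a = i then {j} else if a = j then {i} else {})"
    using assms by auto
  thus ?thesis by simp
qed

text \<open>The base form is nonnegative by Cauchy-Schwarz. A diagonal perturbation only adds a
  nonnegative square to it; the off-diagonal case is \<open>perturbed_form_nonneg\<close>.\<close>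

lemma kernel_matrix_perturbed:
  assumes "s \<ge> 0" "i < m" "j < m" "E = {} \<or> E = {(i, j), (j, i)}"
  shows "kernel_matrix m (perturbed_kernel s m E)"
proof -
  have "0 \<le> v \<bullet> (perturbed_kernel s m E *\<^sub>v v)" if v: "v \<in> carrier_vec m" for v
  proof -
    have base: "0 \<le> (real m + 1) * (\<Sum>b<m. (v $ b)\<^sup>2) - (\<Sum>b<m. v $ b)\<^sup>2"
    proof -
      have "(\<Sum>b<m. v $ b)\<^sup>2 \<le> real m * (\<Sum>b<m. (v $ b)\<^sup>2)"
        using Cauchy_Schwarz_ineq_sum[of "\<lambda>_. 1" "\<lambda>b. v $ b" "{..<m}"] by simp
      moreover have "0 \<le> (\<Sum>b<m. (v $ b)\<^sup>2)"
        by (intro sum_nonneg) simp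
      ultimately show ?thesis
        by (simp add: algebra_simps)
    qed
    show ?thesis
    proof (cases "E = {}")
      case True
      thus ?thesis
        using base assms(1) by (simp add: perturbed_form_eq[OF v])
    next
      case False
      hence E: "E = {(i, j), (j, i)}"
        using assms(4) by simp
      \<comment> \<open>The guard \<open>i \<noteq> j\<close> keeps a diagonal entry from being
        counted twice.\<close>
      have "(\<Sum>a<m. v $ a * (\<Sum>b | b < m \<and> (a, b) \<in> E. v $ b)) =
          (\<Sum>a<m. (if a = i then v $ i * v $ j else 0) + (if a = j \<and> i \<noteq> j then v $ i * v $ j else 0))"
        unfolding E sum_single_partner[OF assms(2,3)] by (intro sum.cong) auto
      also have "\<dots> = v $ i * v $ j + (if i \<noteq> j then v $ i * v $ j else 0)"
        using assms by (cases "i = j") (simp_all add: sum.distrib)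
      finally have eq: "(\<Sum>a<m. v $ a * (\<Sum>b | b < m \<and> (a, b) \<in> E. v $ b)) =
          v $ i * v $ j + (if i \<noteq> j then v $ i * v $ j else 0)" .
      show ?thesis
        using perturbed_form_nonneg[OF assms(2,3), of "\<lambda>b. v $ b"] base assms(1)
        by (cases "i = j") (simp_all add: perturbed_form_eq[OF v] eq)
    qed
  qed
  moreover have "(perturbed_kernel s m E)\<^sup>T = perturbed_kernel s m E"
    using assms(4) by (intro eq_matI) (auto simp: perturbed_kernel_def)
  ultimately show ?thesis
    by (simp add: kernel_matrix_def)
qed

section \<open>Residuals before and after a perturbation\<close>

text \<open>Here \<open>r\<close> is the vector of residuals for the base kernel, and \<open>m + 1 + (\<Sum>t. r t) + r i + r j\<close> is
  the residual at \<open>i\<close> once the entry \<open>(i, j)\<close> is perturbed.\<close>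

lemma perturbed_residual_large:
  fixes r :: "nat \<Rightarrow> real"
  assumes "32 \<le> m" "i < m" "j < m" "(\<Sum>t<m. (r t)\<^sup>2) \<le> real m / 16"
  shows "2 * real m \<le> (real m + 1 + (\<Sum>t<m. r t) + r i + r j)\<^sup>2"
proof -
  have "(\<Sum>t<m. r t)\<^sup>2 \<le> real m * (\<Sum>t<m. (r t)\<^sup>2)"
    using Cauchy_Schwarz_ineq_sum[of "\<lambda>_. 1" r "{..<m}"] by simp
  also have "\<dots> \<le> real m * (real m / 16)"
    using assms by (intro mult_left_mono) auto
  also have "\<dots> = (real m / 4)\<^sup>2"
    by (simp add: power2_eq_square)
  finally have sum: "\<bar>\<Sum>t<m. r t\<bar> \<le> real m / 4"
    using abs_le_square_iff[of "\<Sum>t<m. r t" "real m / 4"] by simp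
  have coord: "\<bar>r t\<bar> \<le> real m / 4" if "t < m" for t
  proof -
    have "(r t)\<^sup>2 \<le> (\<Sum>t<m. (r t)\<^sup>2)"
      using that by (intro member_le_sum) auto
    also have "\<dots> \<le> real m / 16"
      by fact
    also have "\<dots> \<le> (real m / 4)\<^sup>2"
      using assms(1) by (simp add: power2_eq_square)
    finally show ?thesis
      using abs_le_square_iff[of "r t" "real m / 4"] by simp
  qed
  \<comment> \<open>Each of the three error terms is at most \<open>m / 4\<close> in absolute value,
    so at least \<open>m + 1 - 3 * m / 4\<close> remains.\<close>
  have "real m / 4 \<le> real m + 1 + (\<Sum>t<m. r t) + r i + r j"
    using sum coord[OF assms(2)] coord[OF assms(3)] by linarith
  hence "(real m / 4)\<^sup>2 \<le> (real m + 1 + (\<Sum>t<m. r t) + r i + r j)\<^sup>2"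
    by (intro power_mono) auto
  \<comment> \<open>The threshold \<open>32 \<le> m\<close> comes from here: for positive
    \<open>m\<close> it is equivalent to this inequality.\<close>
  moreover have "2 * real m \<le> (real m / 4)\<^sup>2"
    using assms(1) by (simp add: power2_eq_square)
  ultimately show ?thesis
    by linarith
qed

text \<open>One vector cannot serve both kernels. Small excess on the base kernel means small
  residuals, which keep \<open>\<alpha> $ j\<close> of order \<open>1 / s\<close>; the perturbed
  entry then shifts the prediction at \<open>i\<close> by \<open>s * (m + 1) * \<alpha> $ j\<close>,
  which is of order \<open>m\<close>.\<close>

lemma Delta_base_or_perturbed:
  fixes lam :: real and m :: nat
  defines "K \<equiv> perturbed_kernel (16 * lam * real m) m"
    and "y \<equiv> vec m (\<lambda>_. 1)"
  assumes lam: "lam > 0" and m: "32 \<le> m" and \<alpha>: "\<alpha> \<in> carrier_vec m"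
    and small: "Delta squared_loss m \<alpha> (K {}) lam y < 1 / 32"
    and ij: "i < m" "j < m"
  shows "1 \<le> Delta squared_loss m \<alpha> (K {(i, j), (j, i)}) lam y"
proof -
  define s where "s = 16 * lam * real m"
  have s: "s > 0"
    using lam m by (simp add: s_def)
  have kernel: "kernel_matrix m (K {})" "kernel_matrix m (K {(i, j), (j, i)})"
    unfolding K_def s_def[symmetric] using s ij by (intro kernel_matrix_perturbed; auto)+
  define S where "S = (\<Sum>b<m. \<alpha> $ b)"
  define r where "r t = s * ((real m + 1) * \<alpha> $ t - S) - 1" for t
  have pred: "\<alpha> \<bullet> (K E *\<^sub>v unit_vec m t) =
      1 + r t + s * (real m + 1) * (\<Sum>b | b < m \<and> (t, b) \<in> E. \<alpha> $ b)"
    if "t < m" "sym E" for t E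
    using perturbed_kernel_prediction[OF \<alpha> that, of s]
    by (simp add: K_def s_def r_def S_def algebra_simps)
  \<comment> \<open>This competitor predicts 1 everywhere, so only its regularizer remains. The
    scale \<open>s = 16 * lam * m\<close> is chosen to make that
    \<open>lam / 2 * (m / s) = 1 / 32\<close>.\<close>
  have base: "objective squared_loss m (vec m (\<lambda>_. 1 / s)) (K {}) lam y = 1 / 32"
  proof -
    have v: "vec m (\<lambda>_. 1 / s) \<in> carrier_vec m"
      by simp
    have "vec m (\<lambda>_. 1 / s) \<bullet> (K {} *\<^sub>v vec m (\<lambda>_. 1 / s)) = real m / s"
      using s unfolding K_def s_def[symmetric] perturbed_form_eq[OF v]
      by (simp add: power2_eq_square field_simps)
    moreover have "vec m (\<lambda>_. 1 / s) \<bullet> (K {} *\<^sub>v unit_vec m t) = 1" if "t < m" for t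
      unfolding K_def s_def[symmetric] using s that
      by (subst perturbed_kernel_prediction[OF v]) (auto simp: sym_def field_simps)
    ultimately show ?thesis
      using lam m by (simp add: objective_def squared_loss_def y_def s_def)
  qed
  have "(1 / real m) * (\<Sum>t<m. (r t)\<^sup>2) \<le> objective squared_loss m \<alpha> (K {}) lam y"
    using objective_ge_loss[OF kernel(1) lam \<alpha>, of squared_loss y]
    by (simp add: pred sym_def squared_loss_def y_def)
  also have "\<dots> \<le> Delta squared_loss m \<alpha> (K {}) lam y + 1 / 32"
    using Delta_ge[OF kernel(1) lam, of "vec m (\<lambda>_. 1 / s)" \<alpha> y] base by simp
  also have "\<dots> \<le> 1 / 16"
    using small by simp
  finally have "(\<Sum>t<m. (r t)\<^sup>2) \<le> real m / 16"
    using m by (simp add: field_simps)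
  note large = perturbed_residual_large[OF m ij this]
  \<comment> \<open>The all-ones vector is an eigenvector of the base kernel with eigenvalue
    \<open>s\<close>, so summing the residuals isolates \<open>s * S\<close>. The definition of
    \<open>r j\<close> then determines \<open>\<alpha> $ j\<close>.\<close>
  have "(\<Sum>t<m. r t) = s * ((real m + 1) * S - real m * S) - real m"
    unfolding r_def by (simp only: sum_subtractf sum_distrib_left[symmetric] S_def[symmetric]) simp
  hence "s * S = real m + (\<Sum>t<m. r t)"
    by (simp add: algebra_simps)
  hence j_coord: "s * (real m + 1) * \<alpha> $ j = 1 + r j + real m + (\<Sum>t<m. r t)"
    by (simp add: r_def algebra_simps)
  let ?E = "{(i, j), (j, i)}"
  have E: "sym ?E"
    by (auto simp: sym_def)
  have residual: "\<alpha> \<bullet> (K ?E *\<^sub>v unit_vec m i) - 1 = real m + 1 + (\<Sum>t<m. r t) + r i + r j"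
    unfolding pred[OF ij(1) E] sum_single_partner[OF ij] using j_coord by simp
  note large[folded residual]
  hence "2 * real m \<le> squared_loss (\<alpha> \<bullet> (K ?E *\<^sub>v unit_vec m i)) (y $ i)"
    using ij by (simp add: squared_loss_def y_def)
  also have "\<dots> \<le> (\<Sum>t<m. squared_loss (\<alpha> \<bullet> (K ?E *\<^sub>v unit_vec m t)) (y $ t))"
    using ij by (intro member_le_sum) (auto simp: squared_loss_def)
  finally have "2 \<le> (1 / real m) * (\<Sum>t<m. squared_loss (\<alpha> \<bullet> (K ?E *\<^sub>v unit_vec m t)) (y $ t))"
    using m by (simp add: field_simps)
  also have "\<dots> \<le> objective squared_loss m \<alpha> (K ?E) lam y"
    by (rule objective_ge_loss[OF kernel(2) lam \<alpha>])
  finally have "2 \<le> objective squared_loss m \<alpha> (K ?E) lam y" .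
  \<comment> \<open>Predicting 0 for targets 1 costs 1, so an objective of at least 2 leaves an
    excess of at least 1.\<close>
  moreover have "objective squared_loss m (0\<^sub>v m) (K ?E) lam y = 1"
    using m by (subst objective_eq_sums) (auto simp: K_def squared_loss_def y_def)
  ultimately show ?thesis
    using Delta_ge[OF kernel(2) lam, of "0\<^sub>v m" \<alpha> y] by simp
qed

section \<open>Averaging over the perturbations\<close>

text \<open>The bound is for a single deterministic algorithm, so that it can be integrated over
  \<open>P\<close>. Weight \<open>m\<^sup>2\<close> balances the base kernel against the
  \<open>m\<^sup>2\<close> perturbations. Either its excess is at least \<open>1 / 32\<close> and
  the first term suffices, or each perturbation missed by the base run contributes at least
  1.\<close>

lemma sum_Delta_ge:
  fixes lam :: real and m :: nat
  defines "K \<equiv> perturbed_kernel (16 * lam * real m) m"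
    and "y \<equiv> vec m (\<lambda>_. 1)"
  assumes lam: "lam > 0" and m: "32 \<le> m" and B: "4 * B \<le> m\<^sup>2"
    and A: "budgeted_algorithm m B A"
  shows "(real m)\<^sup>2 / 32 \<le> (real m)\<^sup>2 * Delta squared_loss m (returned (K {}) (A y)) (K {}) lam y +
    (\<Sum>(i, j)\<in>{..<m} \<times> {..<m}. Delta squared_loss m (returned (K {(i, j), (j, i)}) (A y))
      (K {(i, j), (j, i)}) lam y)"
proof -
  define D where "D E = Delta squared_loss m (returned (K E) (A y)) (K E) lam y" for E
  have y: "y \<in> carrier_vec m"
    by (simp add: y_def)
  have kernel: "kernel_matrix m (K E)" if "E = {} \<or> E = {(i, j), (j, i)}" "i < m" "j < m" for E i j
    unfolding K_def using lam that by (intro kernel_matrix_perturbed[of _ i m j]) auto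
  \<comment> \<open>The indices \<open>0 0\<close> are placeholders, valid because \<open>m\<close>
    is positive.\<close>
  have kernel0: "kernel_matrix m (K {})"
    using kernel[of "{}" 0 0] m by simp
  have ret: "returned (K E) (A y) \<in> carrier_vec m" if "kernel_matrix m (K E)" for E
    using A y that unfolding budgeted_algorithm_def by blast
  have D_nonneg: "0 \<le> D E" if "kernel_matrix m (K E)" for E
    unfolding D_def using Delta_nonneg[OF that lam ret[OF that]] .
  let ?U = "{..<m} \<times> {..<m}"
  define Q where "Q = queried (K {}) (A y)"
  have Q: "Q \<subseteq> ?U" "card Q \<le> B"
    using A y kernel0 unfolding budgeted_algorithm_def Q_def by blast+
  have fin: "finite Q"
    using Q(1) by (rule finite_subset) simp
  have sum_nn: "0 \<le> (\<Sum>(i, j)\<in>?U. D {(i, j), (j, i)})"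
    by (intro sum_nonneg) (auto intro!: D_nonneg kernel)
  have "(real m)\<^sup>2 / 32 \<le> (real m)\<^sup>2 * D {} + (\<Sum>(i, j)\<in>?U. D {(i, j), (j, i)})"
  proof (cases "D {} < 1 / 32")
    case False
    hence "(real m)\<^sup>2 * (1 / 32) \<le> (real m)\<^sup>2 * D {}"
      by (intro mult_left_mono) auto
    thus ?thesis
      using sum_nn by simp
  next
    case True
    \<comment> \<open>Reading either \<open>(i, j)\<close> or \<open>(j, i)\<close> reveals the
      perturbation, so the queried set is removed together with its mirror image. This costs at most
      \<open>2 * B\<close> pairs, hence at most half of them.\<close>
    let ?M = "?U - (Q \<union> prod.swap ` Q)"
    have missed: "1 \<le> D {(i, j), (j, i)}" if "(i, j) \<in> ?M" for i j
    proof -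
      have ij: "i < m" "j < m" "(i, j) \<notin> Q" "(j, i) \<notin> Q"
        using that by (auto simp: image_iff)
      have "returned (K {(i, j), (j, i)}) (A y) = returned (K {}) (A y)"
      proof (rule returned_cong)
        fix a b assume "(a, b) \<in> queried (K {}) (A y)"
        hence "(a, b) \<in> Q"
          by (simp add: Q_def)
        hence "a < m" "b < m" "(a, b) \<notin> {(i, j), (j, i)}"
          using Q(1) ij by auto
        thus "K {(i, j), (j, i)} $$ (a, b) = K {} $$ (a, b)"
          unfolding K_def by (auto simp: perturbed_kernel_index)
      qed
      thus ?thesis
        using Delta_base_or_perturbed[OF lam m ret[OF kernel0, unfolded K_def], of i j] True ij
        by (simp add: D_def K_def y_def)
    qed
    have "card (Q \<union> prod.swap ` Q) \<le> card Q + card (prod.swap ` Q)"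
      by (rule card_Un_le)
    also have "\<dots> \<le> 2 * B"
      using card_image_le[OF fin, of prod.swap] Q(2) by linarith
    finally have "m\<^sup>2 - 2 * B \<le> card ?U - card (Q \<union> prod.swap ` Q)"
      by (simp add: power2_eq_square)
    also have "\<dots> \<le> card ?M"
      using fin by (intro diff_card_le_card_Diff) auto
    finally have "m\<^sup>2 \<le> 2 * card ?M"
      using B by linarith
    hence "(real m)\<^sup>2 \<le> 2 * real (card ?M)"
      by (metis of_nat_le_iff of_nat_mult of_nat_numeral of_nat_power)
    also have "real (card ?M) = (\<Sum>(i, j)\<in>?M. 1)"
      by simp
    also have "\<dots> \<le> (\<Sum>(i, j)\<in>?M. D {(i, j), (j, i)})"
      using missed by (intro sum_mono) auto
    also have "\<dots> \<le> (\<Sum>(i, j)\<in>?U. D {(i, j), (j, i)})"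
      by (intro sum_mono2) (auto intro!: D_nonneg kernel)
    finally have "(real m)\<^sup>2 \<le> 2 * (\<Sum>(i, j)\<in>?U. D {(i, j), (j, i)})"
      by simp
    moreover have "0 \<le> (real m)\<^sup>2 * D {}"
      using D_nonneg[OF kernel0] by simp
    moreover have "0 \<le> (real m)\<^sup>2"
      by simp
    ultimately show ?thesis
      by linarith
  qed
  thus ?thesis
    by (simp add: D_def)
qed

text \<open>If the base kernel and all perturbations had expected excess at most
  \<open>1 / 100\<close>, integrating \<open>sum_Delta_ge\<close> would give
  \<open>m\<^sup>2 / 32 \<le> 2 * m\<^sup>2 / 100\<close>. Any positive constant below
  \<open>1 / 64\<close> yields the same contradiction.\<close>

lemma expected_Delta_lower_bound:
  fixes lam :: real
  assumes lam: "lam > 0" and m: "32 \<le> m" and B: "4 * B \<le> m\<^sup>2"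
    and P: "randomized_budgeted_algorithm m B P"
  shows "\<exists>K y. kernel_matrix m K \<and> target_values m y \<and>
    ennreal (1 / 100) \<le> expected_Delta squared_loss m P K lam y"
proof (rule ccontr)
  assume contra: "\<not> ?thesis"
  define K where "K = perturbed_kernel (16 * lam * real m) m"
  define y :: "real vec" where "y = vec m (\<lambda>_. 1)"
  define D where "D E A = Delta squared_loss m (returned (K E) (A y)) (K E) lam y"
    for E and A :: "real vec \<Rightarrow> strategy"
  interpret prob_space P
    using P by (simp add: randomized_budgeted_algorithm_def)
  let ?U = "{..<m} \<times> {..<m}"
  let ?E = "\<lambda>(i, j). {(i, j), (j, i)} :: (nat \<times> nat) set"
  have y: "y \<in> carrier_vec m" "target_values m y"
    by (auto simp: y_def target_values_def)
  have kernel: "kernel_matrix m (K E)" if "E = {} \<or> E = {(i, j), (j, i)}" "i < m" "j < m" for E i j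
    unfolding K_def using lam that by (intro kernel_matrix_perturbed[of _ i m j]) auto
  have kernel0: "kernel_matrix m (K {})"
    using kernel[of "{}" 0 0] m by simp
  have kernel1: "kernel_matrix m (K (?E p))" if "p \<in> ?U" for p
    using kernel[of "?E p" "fst p" "snd p"] that by (auto simp: case_prod_unfold)
  have bound: "(\<integral>\<^sup>+ A. ennreal (D E A) \<partial>P) \<le> ennreal (1 / 100)"
      and meas: "D E \<in> borel_measurable P"
      and nonneg: "A \<in> space P \<Longrightarrow> 0 \<le> D E A"
    if "kernel_matrix m (K E)" for E A
  proof -
    show "(\<integral>\<^sup>+ A. ennreal (D E A) \<partial>P) \<le> ennreal (1 / 100)"
      using contra that y(2) unfolding expected_Delta_def D_def by (meson linear)
    show "D E \<in> borel_measurable P"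
      using Delta_measurable[OF P that y(1)] unfolding D_def .
    show "0 \<le> D E A" if "A \<in> space P"
    proof -
      have "budgeted_algorithm m B A"
        using P that by (auto simp: randomized_budgeted_algorithm_def)
      thus ?thesis
        using Delta_nonneg[OF \<open>kernel_matrix m (K E)\<close> lam] \<open>kernel_matrix m (K E)\<close> y(1)
        unfolding D_def budgeted_algorithm_def by blast
    qed
  qed
  have "ennreal ((real m)\<^sup>2 / 32) = (\<integral>\<^sup>+ A. ennreal ((real m)\<^sup>2 / 32) \<partial>P)"
    by (simp add: emeasure_space_1)
  also have "\<dots> \<le> (\<integral>\<^sup>+ A. ennreal ((real m)\<^sup>2) * ennreal (D {} A) + (\<Sum>p\<in>?U. ennreal (D (?E p) A)) \<partial>P)"
  proof (rule nn_integral_mono)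
    fix A assume A: "A \<in> space P"
    have "(real m)\<^sup>2 / 32 \<le> (real m)\<^sup>2 * D {} A + (\<Sum>p\<in>?U. D (?E p) A)"
      using sum_Delta_ge[OF lam m B, of A] P A
      by (simp add: D_def K_def y_def case_prod_unfold randomized_budgeted_algorithm_def)
    hence "ennreal ((real m)\<^sup>2 / 32) \<le> ennreal ((real m)\<^sup>2 * D {} A + (\<Sum>p\<in>?U. D (?E p) A))"
      by (rule ennreal_leI)
    \<comment> \<open>All terms are nonnegative, so \<open>ennreal\<close> passes through the sum
      and the product.\<close>
    also have "\<dots> = ennreal ((real m)\<^sup>2) * ennreal (D {} A) + (\<Sum>p\<in>?U. ennreal (D (?E p) A))"
      using nonneg[OF kernel0 A] nonneg[OF kernel1 A]
      by (subst ennreal_plus) (auto simp: ennreal_mult sum_ennreal intro!: sum_nonneg simp del: ennreal_plus)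
    finally show "ennreal ((real m)\<^sup>2 / 32) \<le>
        ennreal ((real m)\<^sup>2) * ennreal (D {} A) + (\<Sum>p\<in>?U. ennreal (D (?E p) A))" .
  qed
  also have "\<dots> = ennreal ((real m)\<^sup>2) * (\<integral>\<^sup>+ A. ennreal (D {} A) \<partial>P)
      + (\<Sum>p\<in>?U. \<integral>\<^sup>+ A. ennreal (D (?E p) A) \<partial>P)"
  proof -
    note [measurable] = meas[OF kernel0] meas[OF kernel1]
    show ?thesis
      by (simp add: nn_integral_add nn_integral_cmult nn_integral_sum)
  qed
  also have "\<dots> \<le> ennreal ((real m)\<^sup>2) * ennreal (1 / 100) + (\<Sum>p\<in>?U. ennreal (1 / 100))"
    by (intro add_mono mult_left_mono sum_mono bound kernel1 kernel0) auto
  also have "(\<Sum>p\<in>?U. ennreal (1 / 100)) = ennreal (\<Sum>p\<in>?U. 1 / 100)"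
    by (rule sum_ennreal) simp
  also have "ennreal ((real m)\<^sup>2) * ennreal (1 / 100) + \<dots> = ennreal ((real m)\<^sup>2 / 50)"
    by (simp add: ennreal_mult[symmetric] ennreal_plus[symmetric] power2_eq_square del: ennreal_plus)
  finally have "(real m)\<^sup>2 / 32 \<le> (real m)\<^sup>2 / 50"
    by (subst (asm) ennreal_le_iff) auto
  moreover have "0 < (real m)\<^sup>2"
    using m by simp
  ultimately show False
    by linarith
qed

section \<open>The two budget regimes\<close>

theorem corollary4:
  shows "\<exists>c c' :: real. c > 0 \<and> c' > 0 \<and>
    (\<forall>(lam :: real) (m :: nat) (B :: nat). lam > 0 \<longrightarrow> m \<ge> 1 \<longrightarrow> B \<ge> 1 \<longrightarrow>
      (real B \<le> 1 / lam\<^sup>2 \<and> 1 / lam\<^sup>2 \<le> c * (real m)\<^sup>2 \<longrightarrow>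
        (\<forall>P. randomized_budgeted_algorithm m B P \<longrightarrow>
          (\<exists>K y. kernel_matrix m K \<and> target_values m y \<and>
            expected_Delta squared_loss m P K lam y \<ge> ennreal c'))) \<and>
      (1 / lam\<^sup>2 \<le> real B \<and> real B \<le> c * (real m)\<^sup>2 \<longrightarrow>
        (\<forall>P. randomized_budgeted_algorithm m B P \<longrightarrow>
          (\<exists>K y. kernel_matrix m K \<and> target_values m y \<and>
            expected_Delta squared_loss m P K lam y \<ge> ennreal (c' * (lam * sqrt (real B)) powi (-3))))))"
proof (rule exI[of _ "1 / 1024"], rule exI[of _ "1 / 100"], intro conjI allI impI)
  fix lam :: real and m B :: nat and P
  assume lam: "lam > 0" and "1 \<le> B" and P: "randomized_budgeted_algorithm m B P"
  \<comment> \<open>The constant \<open>1 / 1024\<close> is \<open>1 / 32\<^sup>2\<close>: together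
    with \<open>1 \<le> B\<close> it forces \<open>32 \<le> m\<close>.\<close>
  have size: "32 \<le> m \<and> 4 * B \<le> m\<^sup>2" if "real B \<le> 1 / 1024 * (real m)\<^sup>2"
  proof -
    have "real (1024 * B) \<le> real (m\<^sup>2)"
      using that by simp
    hence le: "1024 * B \<le> m\<^sup>2"
      by (simp only: of_nat_le_iff)
    hence "32\<^sup>2 \<le> m\<^sup>2"
      using \<open>1 \<le> B\<close> by simp
    hence "32 \<le> m"
      by (rule power2_le_imp_le) simp
    thus ?thesis
      using le by simp
  qed
  {
    assume "real B \<le> 1 / lam\<^sup>2 \<and> 1 / lam\<^sup>2 \<le> 1 / 1024 * (real m)\<^sup>2"
    hence "real B \<le> 1 / 1024 * (real m)\<^sup>2"
      by linarith
    thus "\<exists>K y. kernel_matrix m K \<and> target_values m y \<and>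
        ennreal (1 / 100) \<le> expected_Delta squared_loss m P K lam y"
      using size expected_Delta_lower_bound[OF lam _ _ P] by blast
  next
    \<comment> \<open>In this regime \<open>lam * sqrt B\<close> is at least 1, so the required rate
      is at most the constant already obtained.\<close>
    assume A: "1 / lam\<^sup>2 \<le> real B \<and> real B \<le> 1 / 1024 * (real m)\<^sup>2"
    hence "1 \<le> lam\<^sup>2 * real B"
      using lam by (simp add: field_simps)
    hence "1 \<le> (lam * sqrt (real B))\<^sup>2"
      by (simp add: power_mult_distrib)
    hence "1 \<le> lam * sqrt (real B)"
      using lam by (intro power2_le_imp_le[of 1]) auto
    hence "(lam * sqrt (real B)) powi (-3) \<le> 1"
      by (simp add: power_int_minus one_le_power inverse_le_1_iff)
    hence "ennreal (1 / 100 * (lam * sqrt (real B)) powi (-3)) \<le> ennreal (1 / 100)"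
      by (intro ennreal_leI) simp
    moreover obtain K y where "kernel_matrix m K" "target_values m y"
        "ennreal (1 / 100) \<le> expected_Delta squared_loss m P K lam y"
      using A size expected_Delta_lower_bound[OF lam _ _ P] by blast
    ultimately show "\<exists>K y. kernel_matrix m K \<and> target_values m y \<and>
        ennreal (1 / 100 * (lam * sqrt (real B)) powi (-3)) \<le> expected_Delta squared_loss m P K lam y"
      by (meson order_trans)
  }
qed simp_all

end
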